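(* Let $U \subseteq \mathbb{R}$ be an interval and let $(f_n)_{n\in\mathbb{N}}$, $f_n\colon U \to \mathbb{R}$, be a family of differentiable functions with nowhere vanishing first derivative which is lower bounded, i.e. there exists $C \in \mathbb{R}$ such that $f_n'(y)/f_n'(x) \ge e^{C(y-x)}$ for all $n \in \mathbb{N}$ and all $x,y\in U$ with $x<y$. Then $(f_n)$ is a max-family if and only if $$\lim_{n\to\infty} \frac{f_n'(q)}{f_n'(p)} = \infty \quad \text{for all } p,q\in U \text{ with } p<q.$$
   Context: For a continuous, strictly monotone function $f\colon U\to\mathbb{R}$ on an interval $U$, a vector of entries $a=(a_1,\ldots,a_r)\in U^r$ ($r \ge 1$) and weights $w=(w_1,\ldots,w_r)$ with $w_i>0$ and $\sum_i w_i=1$, the quasi-arithmetic mean is $\mathcal{A}^{[f]}(a,w):=f^{-1}(w_1f(a_1)+\cdots+w_rf(a_r))$. A family $(f_n)_{n\in\mathbb{N}}$ of continuous, strictly monotone functions on $U$ is called a max-family if $\lim_{n\to\infty}\mathcal{A}^{[f_n]}(a,w)=\max(a)$ for all such $r$, $a$ and $w$, where $\max(a)=\max(a_1,\ldots,a_r)$. At endpoints of $U$ belonging to $U$, derivatives are one-sided. *)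

theory Defs
  imports "HOL-Analysis.Analysis"
begin

definition strictly_monotone_on :: "real set \<Rightarrow> (real \<Rightarrow> real) \<Rightarrow> bool" where
  "strictly_monotone_on U f \<longleftrightarrow> strict_mono_on U f \<or> strict_antimono_on U f"

(* A vector of length r is a function nat => real, of which only the values at
   indices i < r matter. *)

definition is_weight_vector :: "nat \<Rightarrow> (nat \<Rightarrow> real) \<Rightarrow> bool" where
  "is_weight_vector r w \<longleftrightarrow> (\<forall>i<r. w i > 0) \<and> (\<Sum>i<r. w i) = 1"

(* Meaningful for f continuous and strictly monotone on the interval U and entries
   a i in U: then the weighted sum lies in the interval f ` U, where inv_into U f is
   the inverse of f. *)

definition quasi_arith_mean ::
    "real set \<Rightarrow> (real \<Rightarrow> real) \<Rightarrow> nat \<Rightarrow> (nat \<Rightarrow> real) \<Rightarrow> (nat \<Rightarrow> real) \<Rightarrow> real" where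
  "quasi_arith_mean U f r a w = inv_into U f (\<Sum>i<r. w i * f (a i))"

definition max_family :: "real set \<Rightarrow> (nat \<Rightarrow> real \<Rightarrow> real) \<Rightarrow> bool" where
  "max_family U f \<longleftrightarrow>
     (\<forall>n. continuous_on U (f n) \<and> strictly_monotone_on U (f n)) \<and>
     (\<forall>r\<ge>1. \<forall>a w. (\<forall>i<r. a i \<in> U) \<longrightarrow> is_weight_vector r w \<longrightarrow>
        (\<lambda>n. quasi_arith_mean U (f n) r a w) \<longlonglongrightarrow> Max (a ` {..<r}))"

(* The argument f' is the family of derivatives, not the family itself. *)

definition lower_bounded_family :: "real set \<Rightarrow> (nat \<Rightarrow> real \<Rightarrow> real) \<Rightarrow> bool" where
  "lower_bounded_family U f' \<longleftrightarrow>
     (\<exists>C. \<forall>n. \<forall>x\<in>U. \<forall>y\<in>U. x < y \<longrightarrow> f' n y / f' n x \<ge> exp (C * (y - x)))"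

end

theory Submission
  imports Defs
begin

text \<open>A sign change of \<open>f\<^sub>n\<close> does not affect its mean, so all derivatives may be taken positive. Lower
  boundedness says that \<open>f\<^sub>n'(x) exp (- C x)\<close> is nondecreasing, so by the mean value theorem the
  increment of \<open>f\<^sub>n\<close> over \<open>[p, q]\<close> is, up to factors independent of \<open>n\<close>, at least \<open>f\<^sub>n'(p)\<close> and at most
  \<open>f\<^sub>n'(q)\<close>. On the other hand, a mean of \<open>p\<close> and \<open>q\<close> exceeds \<open>t\<close> exactly when the increment over
  \<open>[t, q]\<close> is large compared with that over \<open>[p, t]\<close>.\<close>

section \<open>Weighted sums and quasi-arithmetic means\<close>

lemma weighted_sum_bounds:
  fixes g :: "nat \<Rightarrow> real"
  assumes w: "is_weight_vector r w" and k: "k < r"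
    and lo: "\<And>i. i < r \<Longrightarrow> lo \<le> g i" and hi: "\<And>i. i < r \<Longrightarrow> g i \<le> hi"
  shows "w k * g k + (1 - w k) * lo \<le> (\<Sum>i<r. w i * g i)" "lo \<le> (\<Sum>i<r. w i * g i)"
    "(\<Sum>i<r. w i * g i) \<le> hi"
proof -
  have pos: "\<And>i. i < r \<Longrightarrow> 0 < w i" and one: "(\<Sum>i<r. w i) = 1"
    using w by (auto simp: is_weight_vector_def)
  \<comment> \<open>Subtracting \<open>lo\<close> makes every summand nonnegative, so a single
    summand is at most the whole sum.\<close>
  have "w k * (g k - lo) \<le> (\<Sum>i<r. w i * (g i - lo))"
    using k pos lo by (intro member_le_sum) (auto simp: less_imp_le)
  also have "\<dots> = (\<Sum>i<r. w i * g i) - lo"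
    using one by (simp add: right_diff_distrib sum_subtractf flip: sum_distrib_right)
  finally show *: "w k * g k + (1 - w k) * lo \<le> (\<Sum>i<r. w i * g i)"
    by (simp add: algebra_simps)
  have "0 \<le> w k * (g k - lo)"
    using pos[OF k] lo[OF k] by simp
  with * show "lo \<le> (\<Sum>i<r. w i * g i)"
    by (simp add: algebra_simps)
  have "(\<Sum>i<r. w i * g i) \<le> (\<Sum>i<r. w i * hi)"
    using pos hi by (intro sum_mono mult_left_mono) (auto simp: less_imp_le)
  then show "(\<Sum>i<r. w i * g i) \<le> hi"
    using one by (simp flip: sum_distrib_right)
qed

lemma Min_Max_entries:
  fixes a :: "nat \<Rightarrow> real"
  assumes r: "1 \<le> r" and a: "\<forall>i<r. a i \<in> U"
  shows "Min (a ` {..<r}) \<in> U" "Max (a ` {..<r}) \<in> U"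
    and "Min (a ` {..<r}) \<le> Max (a ` {..<r})"
    and "\<exists>k<r. a k = Max (a ` {..<r})"
proof -
  have fin: "finite (a ` {..<r})" "a ` {..<r} \<noteq> {}"
    using r by (auto simp: lessThan_empty_iff)
  note Min = Min_in[OF fin] and Max = Max_in[OF fin]
  have "a ` {..<r} \<subseteq> U"
    using a by auto
  then show "Min (a ` {..<r}) \<in> U" "Max (a ` {..<r}) \<in> U"
    using Min Max by blast+
  show "Min (a ` {..<r}) \<le> Max (a ` {..<r})"
    using fin Min by simp
  show "\<exists>k<r. a k = Max (a ` {..<r})"
    using Max by (metis imageE lessThan_iff)
qed

lemma strict_mono_on_entries:
  fixes a :: "nat \<Rightarrow> real" and f :: "real \<Rightarrow> real"
  assumes mono: "strict_mono_on U f" and a: "\<forall>i<r. a i \<in> U" and i: "i < r"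
  shows "f (Min (a ` {..<r})) \<le> f (a i)" "f (a i) \<le> f (Max (a ` {..<r}))"
proof -
  have "1 \<le> r"
    using i by simp
  note mM = Min_Max_entries(1,2)[OF this a]
  show "f (Min (a ` {..<r})) \<le> f (a i)" "f (a i) \<le> f (Max (a ` {..<r}))"
    using a i mM by (auto intro!: strict_mono_on_leD[OF mono])
qed

lemma quasi_arith_mean_solves:
  assumes U: "is_interval U" and cont: "continuous_on U f" and mono: "strict_mono_on U f"
    and r: "1 \<le> r" and a: "\<forall>i<r. a i \<in> U" and w: "is_weight_vector r w"
  shows "quasi_arith_mean U f r a w \<in> U"
    "f (quasi_arith_mean U f r a w) = (\<Sum>i<r. w i * f (a i))"
proof -
  let ?A = "a ` {..<r}"
  note mM = Min_Max_entries(1,2)[OF r a]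
  have "f (Min ?A) \<le> (\<Sum>i<r. w i * f (a i))" "(\<Sum>i<r. w i * f (a i)) \<le> f (Max ?A)"
    using weighted_sum_bounds[OF w, of 0 "f (Min ?A)" "\<lambda>i. f (a i)" "f (Max ?A)"] r
      strict_mono_on_entries[OF mono a] by auto
  moreover have "is_interval (f ` U)"
    using U cont by (simp add: is_interval_connected_1 connected_continuous_image)
  ultimately have "(\<Sum>i<r. w i * f (a i)) \<in> f ` U"
    using mM by (meson image_eqI mem_is_interval_1_I)
  then show "quasi_arith_mean U f r a w \<in> U"
    "f (quasi_arith_mean U f r a w) = (\<Sum>i<r. w i * f (a i))"
    unfolding quasi_arith_mean_def by (auto intro: inv_into_into f_inv_into_f)
qed

text \<open>Applying the increasing \<open>f\<close> removes the inverse, so that bounds on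
  increments of \<open>f\<close> can be used to compare a mean with \<open>t\<close>.\<close>

lemma quasi_arith_mean_less_iff:
  assumes "is_interval U" "continuous_on U f" "strict_mono_on U f"
    and "1 \<le> r" "\<forall>i<r. a i \<in> U" "is_weight_vector r w" "t \<in> U"
  shows "t < quasi_arith_mean U f r a w \<longleftrightarrow> f t < (\<Sum>i<r. w i * f (a i))"
  using quasi_arith_mean_solves[OF assms(1-6)] strict_mono_on_less[OF assms(3,7)] by metis

lemma quasi_arith_mean_between:
  assumes U: "is_interval U" and cont: "continuous_on U f" and mono: "strict_mono_on U f"
    and r: "1 \<le> r" and a: "\<forall>i<r. a i \<in> U" and w: "is_weight_vector r w"
  shows "Min (a ` {..<r}) \<le> quasi_arith_mean U f r a w"
    "quasi_arith_mean U f r a w \<le> Max (a ` {..<r})"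
proof -
  let ?A = "a ` {..<r}" and ?m = "quasi_arith_mean U f r a w"
  note mM = Min_Max_entries(1,2)[OF r a]
  have "f (Min ?A) \<le> f ?m" "f ?m \<le> f (Max ?A)"
    using weighted_sum_bounds[OF w, of 0 "f (Min ?A)" "\<lambda>i. f (a i)" "f (Max ?A)"] r
      strict_mono_on_entries[OF mono a]
      quasi_arith_mean_solves(2)[OF U cont mono r a w] by auto
  then show "Min ?A \<le> ?m" "?m \<le> Max ?A"
    using quasi_arith_mean_solves(1)[OF U cont mono r a w] mM
    by (auto simp: strict_mono_on_less_eq[OF mono])
qed

text \<open>Negating \<open>f n\<close> negates the weighted sum as well, so \<open>inv_into\<close>
  chooses from the same set of preimages and the means agree literally. Increasing and decreasing
  functions are exchanged.\<close>

lemma max_family_sign: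
  assumes "\<And>n. s n = 1 \<or> s n = (-1 :: real)"
  shows "max_family U (\<lambda>n x. s n * f n x) \<longleftrightarrow> max_family U f"
proof -
  have mean: "quasi_arith_mean U (\<lambda>x. s n * f n x) r a w = quasi_arith_mean U (f n) r a w" for n r a w
    using assms[of n] by (auto simp: quasi_arith_mean_def inv_into_def sum_negf)
  have cont: "continuous_on U (\<lambda>x. s n * f n x) \<longleftrightarrow> continuous_on U (f n)" for n
    using assms[of n] by (auto simp: continuous_on_minus dest: continuous_on_minus)
  have mono: "strictly_monotone_on U (\<lambda>x. s n * f n x) \<longleftrightarrow> strictly_monotone_on U (f n)" for n
    using assms[of n] by (auto simp: strictly_monotone_on_def monotone_on_def)
  show ?thesis
    unfolding max_family_def mean cont mono ..
qed

section \<open>Increments compared with derivatives at endpoints\<close>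

lemma mvt_is_interval:
  fixes f f' :: "real \<Rightarrow> real"
  assumes U: "is_interval U"
    and deriv: "\<And>x. x \<in> U \<Longrightarrow> (f has_real_derivative f' x) (at x within U)"
    and pq: "p \<in> U" "q \<in> U" "p < q"
  obtains x where "p \<le> x" "x \<le> q" "x \<in> U" "f q - f p = f' x * (q - p)"
proof -
  have sub: "{p..q} \<subseteq> U"
    using U pq by (meson atLeastAtMost_iff mem_is_interval_1_I subsetI)
  \<comment> \<open>Derivatives within \<open>U\<close> restrict to \<open>{p..q}\<close>, so
    one-sided derivatives at endpoints of \<open>U\<close> are covered.\<close>
  have "(f has_derivative (*) (f' x)) (at x within {p..q})" if "p \<le> x" "x \<le> q" for x
    using has_field_derivative_subset[OF deriv sub, of x] sub that
    by (auto simp: has_field_derivative_def)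
  then have "\<exists>x\<in>{p..q}. f q - f p = f' x * (q - p)"
    using pq by (intro mvt_very_simple) auto
  then show thesis
    using sub that by (metis atLeastAtMost_iff subsetD)
qed

text \<open>The increment is \<open>q - p\<close> times the derivative at an intermediate point, and
  lower boundedness compares that derivative with those at \<open>p\<close> and \<open>q\<close>.
  Since \<open>E\<close> depends only on \<open>C\<close> and \<open>q - p\<close>, the estimates
  are uniform over a family with common \<open>C\<close>.\<close>

lemma increment_bounds:
  fixes f f' :: "real \<Rightarrow> real"
  assumes U: "is_interval U"
    and deriv: "\<And>x. x \<in> U \<Longrightarrow> (f has_real_derivative f' x) (at x within U)"
    and pos: "\<And>x. x \<in> U \<Longrightarrow> 0 < f' x"
    and bound: "\<And>x y. x \<in> U \<Longrightarrow> y \<in> U \<Longrightarrow> x < y \<Longrightarrow> exp (C * (y - x)) \<le> f' y / f' x"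
    and pq: "p \<in> U" "q \<in> U" "p < q"
  defines "E \<equiv> exp (\<bar>C\<bar> * (q - p))"
  shows "(q - p) * f' p \<le> E * (f q - f p)" "f q - f p \<le> E * ((q - p) * f' q)"
proof -
  obtain x where x: "p \<le> x" "x \<le> q" "x \<in> U" and fx: "f q - f p = f' x * (q - p)"
    using mvt_is_interval[OF U deriv pq] .
  \<comment> \<open>Using the absolute value of \<open>C\<close> gives one constant for either sign
    of \<open>C\<close> and for all subintervals of \<open>{p..q}\<close>.\<close>
  have growth: "f' u \<le> E * f' v" if "u \<in> U" "v \<in> U" "p \<le> u" "u \<le> v" "v \<le> q" for u v
  proof (cases "u = v")
    case True
    then show ?thesis
      using pos[OF that(1)] pq by (simp add: E_def)
  next
    case False
    have "- (\<bar>C\<bar> * (q - p)) \<le> - (\<bar>C\<bar> * (v - u))"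
      using that by (intro le_imp_neg_le mult_left_mono) auto
    also have "\<dots> \<le> C * (v - u)"
      using that mult_right_mono[of "- \<bar>C\<bar>" C "v - u"] by simp
    finally have "inverse E \<le> exp (C * (v - u))"
      by (simp add: E_def flip: exp_minus)
    also have "\<dots> \<le> f' v / f' u"
      using that False by (intro bound) auto
    finally show ?thesis
      using pos[OF that(1)] by (simp add: E_def field_simps)
  qed
  show "(q - p) * f' p \<le> E * (f q - f p)"
    using mult_left_mono[OF growth[of p x], of "q - p"] x pq by (simp add: fx mult_ac)
  show "f q - f p \<le> E * ((q - p) * f' q)"
    using mult_left_mono[OF growth[of x q], of "q - p"] x pq by (simp add: fx mult_ac)
qed

lemma strict_mono_on_of_pos_deriv:
  assumes U: "is_interval U"
    and deriv: "\<And>x. x \<in> U \<Longrightarrow> (f has_real_derivative f' x) (at x within U)"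
    and pos: "\<And>x. x \<in> U \<Longrightarrow> 0 < f' x"
  shows "strict_mono_on U f"
proof (rule strict_mono_onI)
  fix p q assume pq: "p \<in> U" "q \<in> U" "p < q"
  obtain x where "x \<in> U" "f q - f p = f' x * (q - p)"
    using mvt_is_interval[OF U deriv pq] .
  then show "f p < f q"
    using pos[of x] pq by (metis diff_gt_0_iff_gt mult_pos_pos)
qed

section \<open>The equivalence for positive derivatives\<close>

lemma max_family_iff_pos:
  fixes f f' :: "nat \<Rightarrow> real \<Rightarrow> real"
  assumes U: "is_interval U"
    and deriv: "\<And>n x. x \<in> U \<Longrightarrow> (f n has_real_derivative f' n x) (at x within U)"
    and pos: "\<And>n x. x \<in> U \<Longrightarrow> 0 < f' n x"
    and bound: "\<And>n x y. x \<in> U \<Longrightarrow> y \<in> U \<Longrightarrow> x < y \<Longrightarrow> exp (C * (y - x)) \<le> f' n y / f' n x"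
  shows "max_family U f \<longleftrightarrow>
    (\<forall>p\<in>U. \<forall>q\<in>U. p < q \<longrightarrow> filterlim (\<lambda>n. f' n q / f' n p) at_top sequentially)"
proof -
  have cont: "continuous_on U (f n)" for n
    using deriv by (rule DERIV_continuous_on)
  have mono: "strict_mono_on U (f n)" for n
    using U deriv pos by (rule strict_mono_on_of_pos_deriv)
  have incr: "(q - p) * f' n p \<le> exp (\<bar>C\<bar> * (q - p)) * (f n q - f n p)"
    "f n q - f n p \<le> exp (\<bar>C\<bar> * (q - p)) * ((q - p) * f' n q)"
    if "p \<in> U" "q \<in> U" "p < q" for n p q
    using increment_bounds[of U "f n" "f' n" C p q] U deriv pos bound that by blast+
  show ?thesis
  proof (intro iffI ballI impI)
    fix p q assume fam: "max_family U f" and pq: "p \<in> U" "q \<in> U" "p < q"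
    \<comment> \<open>At the midpoint both halves have the same length: one \<open>E\<close> serves
      both, and the length factors cancel.\<close>
    define t where "t = (p + q) / 2"
    have t: "p < t" "t < q" "q - t = t - p"
      using pq by (auto simp: t_def field_simps)
    then have tU: "t \<in> U"
      using mem_is_interval_1_I[OF U pq(1,2)] by simp
    define E where "E = exp (\<bar>C\<bar> * (t - p))"
    have "E > 0" by (simp add: E_def)
    show "filterlim (\<lambda>n. f' n q / f' n p) at_top sequentially"
      unfolding filterlim_at_top_gt[where c = 0]
    proof (intro allI impI)
      fix Z :: real assume "Z > 0"
      \<comment> \<open>The bounds for the two halves each cost a factor \<open>E\<close>; the
        product absorbs both.\<close>
      define K where "K = E * E * Z"
      have "K > 0" using \<open>Z > 0\<close> \<open>E > 0\<close> by (simp add: K_def)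
      \<comment> \<open>weight chosen so that a mean above \<open>t\<close> forces the increment ratio to exceed \<open>K\<close>\<close>
      define w where "w i = (if i = 0 then K / (1 + K) else 1 / (1 + K))" for i :: nat
      define a where "a i = (if i = 0 then p else q)" for i :: nat
      have two: "{..<2} = {0, 1 :: nat}" by auto
      have w: "is_weight_vector 2 w"
        using \<open>K > 0\<close> by (auto simp: is_weight_vector_def w_def two field_simps)
      have a: "\<forall>i<2. a i \<in> U" using pq by (auto simp: a_def)
      have "Max (a ` {..<2}) = q" using pq by (simp add: two a_def)
      then have "(\<lambda>n. quasi_arith_mean U (f n) 2 a w) \<longlonglongrightarrow> q"
        using fam a w unfolding max_family_def
        by (metis one_le_numeral)
      then have "\<forall>\<^sub>F n in sequentially. t < quasi_arith_mean U (f n) 2 a w"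
        using t by (intro order_tendstoD)
      then show "\<forall>\<^sub>F n in sequentially. Z \<le> f' n q / f' n p"
      proof eventually_elim
        case (elim n)
        then have "f n t < (\<Sum>i<2. w i * f n (a i))"
          using quasi_arith_mean_less_iff[OF U cont mono _ a w tU] by simp
        also have "\<dots> = (K * f n p + f n q) / (1 + K)"
          by (simp add: two w_def a_def add_divide_distrib)
        finally have "K * (f n t - f n p) < f n q - f n t"
          using \<open>K > 0\<close> by (simp add: field_simps)
        also have "\<dots> \<le> E * ((t - p) * f' n q)"
          using incr(2)[OF tU pq(2) t(2)] by (simp add: E_def t)
        finally have "E * (E * Z * (f n t - f n p)) < E * ((t - p) * f' n q)"
          by (simp add: K_def mult_ac)
        then have "E * Z * (f n t - f n p) < (t - p) * f' n q"
          using \<open>E > 0\<close> by simp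
        moreover have "Z * ((t - p) * f' n p) \<le> Z * (E * (f n t - f n p))"
          using incr(1)[OF pq(1) tU t(1)] \<open>Z > 0\<close> by (simp add: E_def)
        ultimately have "(t - p) * (Z * f' n p) < (t - p) * f' n q"
          by (simp add: mult_ac)
        then have "Z * f' n p < f' n q"
          using t by simp
        then show ?case
          using pos[OF pq(1), of n] by (simp add: pos_le_divide_eq)
      qed
    qed
  next
    assume lim: "\<forall>p\<in>U. \<forall>q\<in>U. p < q \<longrightarrow> filterlim (\<lambda>n. f' n q / f' n p) at_top sequentially"
    have "(\<lambda>n. quasi_arith_mean U (f n) r a w) \<longlonglongrightarrow> Max (a ` {..<r})"
      if r: "1 \<le> r" and a: "\<forall>i<r. a i \<in> U" and w: "is_weight_vector r w" for r a w
    proof (rule order_tendstoI)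
      fix u assume "Max (a ` {..<r}) < u"
      then show "\<forall>\<^sub>F n in sequentially. quasi_arith_mean U (f n) r a w < u"
        using quasi_arith_mean_between(2)[OF U cont mono r a w]
        by (intro always_eventually allI) (rule le_less_trans)
    next
      define m M where "m = Min (a ` {..<r})" and "M = Max (a ` {..<r})"
      fix l assume "l < Max (a ` {..<r})"
      then have l: "l < M" by (simp add: M_def)
      \<comment> \<open>One index attaining the maximum suffices: all other entries will be
        estimated below by the minimum \<open>m\<close>, leaving two points \<open>m\<close> and
        \<open>M\<close>.\<close>
      obtain k where k: "k < r" "a k = M"
        using Min_Max_entries(4)[OF r a] unfolding M_def by auto
      have mM: "m \<in> U" "M \<in> U" "m \<le> M"
        using Min_Max_entries(1-3)[OF r a] by (auto simp: m_def M_def)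
      show "\<forall>\<^sub>F n in sequentially. l < quasi_arith_mean U (f n) r a w"
      proof (cases "m = M")
        case True
        then show ?thesis
          using quasi_arith_mean_between(1)[OF U cont mono r a w] l
          by (intro always_eventually allI) (auto simp flip: m_def intro: less_le_trans)
      next
        case False
        \<comment> \<open>The given \<open>l\<close> may lie below \<open>m\<close> or outside
          \<open>U\<close>, so it is raised to a point strictly between \<open>m\<close> and
          \<open>M\<close>. The gap from \<open>t\<close> to \<open>s\<close> is where the
          derivative ratio blows up: \<open>f' n t\<close> controls the increment over
          \<open>{m..t}\<close> from above, \<open>f' n s\<close> the one over \<open>{s..M}\<close>
          from below.\<close>
        define t where "t = max l ((m + M) / 2)"
        define s where "s = (t + M) / 2"
        have ts: "l \<le> t" "m < t" "t < s" "s < M"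
          using False mM l by (auto simp: t_def s_def max_def field_simps)
        have tsU: "t \<in> U" "s \<in> U"
          using ts mem_is_interval_1_I[OF U mM(1,2)] by simp_all
        define E where "E = exp (\<bar>C\<bar> * (t - m))"
        define F where "F = exp (\<bar>C\<bar> * (M - s))"
        have EF: "E > 0" "F > 0" by (auto simp: E_def F_def)
        have wk: "w k > 0" using w k by (auto simp: is_weight_vector_def)
        have wk1: "w k \<le> 1"
          using w k member_le_sum[of k "{..<r}" w]
          by (auto simp: is_weight_vector_def less_imp_le)
        \<comment> \<open>Beyond this ratio, \<open>w k\<close> times the lower bound over
          \<open>{s..M}\<close> exceeds \<open>1 - w k\<close> times the upper bound over
          \<open>{m..t}\<close>.\<close>
        define Z where "Z = (1 - w k) * E * (t - m) * F / (w k * (M - s))"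
        have "\<forall>\<^sub>F n in sequentially. Z < f' n s / f' n t"
          using lim tsU ts by (auto simp: filterlim_at_top_dense)
        then show ?thesis
        proof eventually_elim
          case (elim n)
          have "F * ((1 - w k) * (f n t - f n m)) \<le> F * ((1 - w k) * (E * ((t - m) * f' n t)))"
            using incr(2)[OF mM(1) tsU(1) ts(2)] wk1 EF
            by (intro mult_left_mono) (auto simp: E_def)
          also have "\<dots> = Z * f' n t * (w k * (M - s))"
            using wk ts by (simp add: Z_def)
          also have "\<dots> < f' n s * (w k * (M - s))"
            using elim pos[OF tsU(1), of n] wk ts
            by (intro mult_strict_right_mono) (auto simp: field_simps)
          also have "\<dots> \<le> w k * (F * (f n M - f n s))"
            using mult_left_mono[OF incr(1)[OF tsU(2) mM(2) ts(4)], of "w k" n] wk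
            by (simp add: F_def mult_ac)
          \<comment> \<open>The increment over \<open>{t..s}\<close> is positive and may be added,
            which eliminates \<open>s\<close>.\<close>
          also have "\<dots> \<le> w k * (F * (f n M - f n t))"
            using wk EF strict_mono_onD[OF mono[of n] tsU ts(3)]
            by (intro mult_left_mono) auto
          finally have "F * ((1 - w k) * (f n t - f n m)) < F * (w k * (f n M - f n t))"
            by (simp add: mult_ac)
          then have "(1 - w k) * (f n t - f n m) < w k * (f n M - f n t)"
            using EF by simp
          then have "f n t < w k * f n (a k) + (1 - w k) * f n m"
            by (simp add: k algebra_simps)
          also have "\<dots> \<le> (\<Sum>i<r. w i * f n (a i))"
            using weighted_sum_bounds(1)[OF w k(1), of "f n m" "\<lambda>i. f n (a i)" "f n M"]
              strict_mono_on_entries[OF mono a] by (simp add: m_def M_def)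
          finally have "t < quasi_arith_mean U (f n) r a w"
            using quasi_arith_mean_less_iff[OF U cont mono r a w tsU(1)] by blast
          with ts(1) show ?case
            by (rule le_less_trans)
        qed
      qed
    qed
    then show "max_family U f"
      using cont mono by (auto simp: max_family_def strictly_monotone_on_def)
  qed
qed

section \<open>Reduction to positive derivatives\<close>

lemma constant_sign:
  fixes g :: "real \<Rightarrow> real"
  assumes ratio: "\<And>x y. x \<in> U \<Longrightarrow> y \<in> U \<Longrightarrow> x < y \<Longrightarrow> 0 < g y / g x"
    and nz: "\<And>x. x \<in> U \<Longrightarrow> g x \<noteq> 0"
  obtains s :: real where "s = 1 \<or> s = -1" "\<And>x. x \<in> U \<Longrightarrow> 0 < s * g x"
proof (cases "\<exists>x\<in>U. g x < 0")
  case True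
  then obtain z where z: "z \<in> U" "g z < 0" by auto
  \<comment> \<open>Whichever of \<open>x\<close> and \<open>z\<close> is larger, their ratio is
    positive, so \<open>x\<close> inherits the sign at \<open>z\<close>.\<close>
  have "g x < 0" if "x \<in> U" for x
    using ratio[OF z(1) that] ratio[OF that z(1)] z
    by (cases x z rule: linorder_cases) (auto simp: zero_less_divide_iff)
  then show ?thesis
    by (intro that[of "-1"]) auto
next
  case False
  then show ?thesis
    using nz by (intro that[of 1]) (auto simp: not_less less_le)
qed

theorem theorem3p1:
  fixes U :: "real set" and f f' :: "nat \<Rightarrow> real \<Rightarrow> real"
  assumes "is_interval U"
    and "\<And>n x. x \<in> U \<Longrightarrow> (f n has_real_derivative f' n x) (at x within U)"
    and "\<And>n x. x \<in> U \<Longrightarrow> f' n x \<noteq> 0"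
    and "lower_bounded_family U f'"
  shows "max_family U f \<longleftrightarrow>
    (\<forall>p\<in>U. \<forall>q\<in>U. p < q \<longrightarrow> filterlim (\<lambda>n. f' n q / f' n p) at_top sequentially)"
proof -
  obtain C where C: "\<And>n x y. x \<in> U \<Longrightarrow> y \<in> U \<Longrightarrow> x < y \<Longrightarrow> exp (C * (y - x)) \<le> f' n y / f' n x"
    using assms(4) by (auto simp: lower_bounded_family_def)
  have "0 < f' n y / f' n x" if "x \<in> U" "y \<in> U" "x < y" for n x y
    using C[OF that, of n] exp_gt_zero by (rule less_le_trans[rotated])
  then have "\<exists>s::real. (s = 1 \<or> s = -1) \<and> (\<forall>x\<in>U. 0 < s * f' n x)" for n
    using constant_sign[of U "f' n"] assms(3) by metis
  then obtain s :: "nat \<Rightarrow> real" where s: "\<And>n. s n = 1 \<or> s n = -1"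
    and pos: "\<And>n x. x \<in> U \<Longrightarrow> 0 < s n * f' n x"
    by metis
  \<comment> \<open>The sign, chosen separately for each \<open>n\<close>, cancels here, so the
    lower bound with the same \<open>C\<close> and the limit condition carry over unchanged.\<close>
  have ratio: "(s n * f' n y) / (s n * f' n x) = f' n y / f' n x" for n x y
    using s[of n] by auto
  have "max_family U (\<lambda>n x. s n * f n x) \<longleftrightarrow>
    (\<forall>p\<in>U. \<forall>q\<in>U. p < q \<longrightarrow>
      filterlim (\<lambda>n. (s n * f' n q) / (s n * f' n p)) at_top sequentially)"
    using assms(1) DERIV_cmult[OF assms(2)] pos C
    by (intro max_family_iff_pos[where C = C]) (auto simp only: ratio)
  then show ?thesis
    by (simp only: ratio max_family_sign[OF s])
qed

end
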